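(* In every valid Septoku board $s$, the seven values $s(6), s(8), s(17), s(19), s(21), s(30), s(32)$ at the centers of the seven circles are pairwise distinct.
   Context: The Septoku board consists of 37 cells forming a regular hexagon of side 4 in a hexagonal grid, numbered row by row: $1$–$4$ (top row), $5$–$9$, $10$–$15$, $16$–$22$, $23$–$28$, $29$–$33$, $34$–$37$ (bottom row). The 21 "rows" of the board (lines of cells in the three grid directions) are: horizontal $\{1,2,3,4\}$, $\{5,\dots,9\}$, $\{10,\dots,15\}$, $\{16,\dots,22\}$, $\{23,\dots,28\}$, $\{29,\dots,33\}$, $\{34,\dots,37\}$; up-right $\{1,5,10,16\}$, $\{2,6,11,17,23\}$, $\{3,7,12,18,24,29\}$, $\{4,8,13,19,25,30,34\}$, $\{9,14,20,26,31,35\}$, $\{15,21,27,32,36\}$, $\{22,28,33,37\}$; down-right $\{4,9,15,22\}$, $\{3,8,14,21,28\}$, $\{2,7,13,20,27,33\}$, $\{1,6,12,19,26,32,37\}$, $\{5,11,18,25,31,36\}$, $\{10,17,24,30,35\}$, $\{16,23,29,34\}$. The seven "circles" (a center cell with its six neighbours) are: circle 6 $=\{1,2,5,6,7,11,12\}$, circle 8 $=\{3,4,7,8,9,13,14\}$, circle 17 $=\{10,11,16,17,18,23,24\}$, circle 19 $=\{12,13,18,19,20,25,26\}$, circle 21 $=\{14,15,20,21,22,27,28\}$, circle 30 $=\{24,25,29,30,31,34,35\}$, circle 32 $=\{26,27,31,32,33,36,37\}$. A valid Septoku board is a map $s:\{1,\dots,37\}\to\{1,\dots,7\}$ such that the cells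 of each of the 21 rows receive pairwise distinct values and the seven cells of each circle receive pairwise distinct values (i.e. all seven symbols). *)

theory Defs
  imports Main "HOL-Library.FuncSet"
begin

text \<open>
  The cells of the hexagonal board of side 4 are numbered row by row, from the top left to the
  bottom right.
\<close>

definition septoku_cells :: "nat set" where
  "septoku_cells = {1..37}"

definition horizontal_rows :: "nat set set" where
  "horizontal_rows =
    {{1..4}, {5..9}, {10..15}, {16..22}, {23..28}, {29..33}, {34..37}}"

definition up_right_rows :: "nat set set" where
  "up_right_rows =
    {{1, 5, 10, 16},
     {2, 6, 11, 17, 23},
     {3, 7, 12, 18, 24, 29},
     {4, 8, 13, 19, 25, 30, 34},
     {9, 14, 20, 26, 31, 35},
     {15, 21, 27, 32, 36},
     {22, 28, 33, 37}}"

definition down_right_rows :: "nat set set" where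
  "down_right_rows =
    {{4, 9, 15, 22},
     {3, 8, 14, 21, 28},
     {2, 7, 13, 20, 27, 33},
     {1, 6, 12, 19, 26, 32, 37},
     {5, 11, 18, 25, 31, 36},
     {10, 17, 24, 30, 35},
     {16, 23, 29, 34}}"

definition septoku_rows :: "nat set set" where
  "septoku_rows = horizontal_rows \<union> up_right_rows \<union> down_right_rows"

text \<open>The circles, in the order of their centers 6, 8, 17, 19, 21, 30, 32.\<close>

definition septoku_circles :: "nat set set" where
  "septoku_circles =
    {{1, 2, 5, 6, 7, 11, 12},
     {3, 4, 7, 8, 9, 13, 14},
     {10, 11, 16, 17, 18, 23, 24},
     {12, 13, 18, 19, 20, 25, 26},
     {14, 15, 20, 21, 22, 27, 28},
     {24, 25, 29, 30, 31, 34, 35},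
     {26, 27, 31, 32, 33, 36, 37}}"

text \<open>A board is a function on all of \<open>nat\<close>, of which only the values on the cells matter.\<close>

definition valid_septoku :: "(nat \<Rightarrow> nat) \<Rightarrow> bool" where
  "valid_septoku s \<longleftrightarrow>
     s \<in> septoku_cells \<rightarrow> {1..7} \<and>
     (\<forall>R\<in>septoku_rows. inj_on s R) \<and>
     (\<forall>C\<in>septoku_circles. inj_on s C)"

end

theory Submission imports Defs begin

text \<open>
  Two circle centers that do not already share a row are related by a rotation of the board
  to the pair 6, 21. Every symbol occurs in every circle. If 6 and 21 carried the same symbol,
  then circles 8 and 19 would force it onto cell 13, circle 17 would force it onto cell 24, and
  no cell of circle 32 would be left for it.
\<close>

text \<open>Pigeonhole: seven cells with distinct values among seven symbols use every
  symbol.\<close>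

lemma valid_septoku_circle_surj:
  assumes "valid_septoku s" "C \<in> septoku_circles" "v \<in> {1..7}"
  shows "\<exists>c\<in>C. s c = v"
proof -
  have cells: "C \<subseteq> septoku_cells" "card C = 7"
    using assms(2) by (auto simp: septoku_circles_def septoku_cells_def)
  have "s ` C \<subseteq> {1..7}"
    using assms(1) cells by (auto simp: valid_septoku_def Pi_iff)
  moreover have "card (s ` C) = 7"
    using assms cells by (simp add: valid_septoku_def card_image)
  ultimately have "s ` C = {1..7}"
    by (intro card_subset_eq) auto
  with assms(3) show ?thesis
    by (metis imageE)
qed

lemma valid_septoku_neq:
  assumes "valid_septoku s" "R \<in> septoku_rows \<union> septoku_circles" "a \<in> R" "b \<in> R" "a \<noteq> b"
  shows "s a \<noteq> s b"
  using assms by (meson UnE inj_onD valid_septoku_def)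

lemma valid_septoku_6_neq_21:
  assumes "valid_septoku s"
  shows "s 6 \<noteq> s 21"
proof
  assume eq: "s 6 = s 21"
  note neq = valid_septoku_neq[OF assms]
  note defs = septoku_rows_def horizontal_rows_def up_right_rows_def down_right_rows_def
    septoku_circles_def
  have row6: "s c \<noteq> s 6" if "c \<in> {1, 2, 5, 7, 8, 9, 11, 12, 17, 19, 23, 26, 32, 37}" for c
    using that neq[of "{5..9}" c 6] neq[of "{2, 6, 11, 17, 23}" c 6]
      neq[of "{1, 6, 12, 19, 26, 32, 37}" c 6] by (auto simp: defs)
  \<comment> \<open>The cells in line with 21 that lie in circles 8, 17, 19 or 32.\<close>
  have row21: "s c \<noteq> s 6" if "c \<in> {3, 8, 14, 16, 17, 18, 19, 20, 27, 32, 36}" for c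
    using that neq[of "{16..22}" c 21] neq[of "{15, 21, 27, 32, 36}" c 21]
      neq[of "{3, 8, 14, 21, 28}" c 21] by (auto simp: defs eq)
  have "s 6 \<in> {1..7}"
    using assms by (auto simp: valid_septoku_def septoku_cells_def)
  note occurs = valid_septoku_circle_surj[OF assms _ this]
  have "\<exists>c\<in>{3, 4, 7, 8, 9, 13, 14}. s c = s 6"
    by (rule occurs) (simp add: septoku_circles_def)
  then have "s 4 = s 6 \<or> s 13 = s 6"
    using row6 row21 by auto
  moreover have "\<exists>c\<in>{12, 13, 18, 19, 20, 25, 26}. s c = s 6"
    by (rule occurs) (simp add: septoku_circles_def)
  then have "s 13 = s 6 \<or> s 25 = s 6"
    using row6 row21 by auto
  \<comment> \<open>If 13 did not carry the symbol, both 4 and 25 would, although they share a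
    row.\<close>
  moreover have "s 4 \<noteq> s 25"
    by (rule neq[of "{4, 8, 13, 19, 25, 30, 34}"]) (simp_all add: defs)
  ultimately have s13: "s 13 = s 6"
    by metis
  \<comment> \<open>In circle 17 only 10 and 24 are still possible, and 10 is in line with
    13.\<close>
  have "s 10 \<noteq> s 13"
    by (rule neq[of "{10..15}"]) (simp_all add: defs)
  moreover have "\<exists>c\<in>{10, 11, 16, 17, 18, 23, 24}. s c = s 6"
    by (rule occurs) (simp add: septoku_circles_def)
  ultimately have s24: "s 24 = s 6"
    using row6 row21 s13 by auto
  \<comment> \<open>Circle 32 retains 31 and 33. Cells 24 and 31 share no row, so 31 is excluded
    through circle 30; the row through 13 excludes 33.\<close>
  have "s 31 \<noteq> s 24"
    by (rule neq[of "{24, 25, 29, 30, 31, 34, 35}"]) (simp_all add: defs)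
  moreover have "s 33 \<noteq> s 13"
    by (rule neq[of "{2, 7, 13, 20, 27, 33}"]) (simp_all add: defs)
  moreover have "\<exists>c\<in>{26, 27, 31, 32, 33, 36, 37}. s c = s 6"
    by (rule occurs) (simp add: septoku_circles_def)
  ultimately show False
    using row6 row21 s13 s24 by auto
qed

text \<open>
  The clockwise rotation by 60 degrees; each line of the list is the image of one horizontal row.
  The leading 0 accounts for the cell numbers starting at 1.
\<close>

definition rotate_cell :: "nat \<Rightarrow> nat" where
  "rotate_cell c =
    [0,
     4, 9, 15, 22,
     3, 8, 14, 21, 28,
     2, 7, 13, 20, 27, 33,
     1, 6, 12, 19, 26, 32, 37,
     5, 11, 18, 25, 31, 36,
     10, 17, 24, 30, 35,
     16, 23, 29, 34] ! c"

text \<open>The rotation is injective on the cells and sends rows to rows and circles to circles, so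
  distinctness on each image pulls back.\<close>

lemma valid_septoku_rotate:
  assumes "valid_septoku s"
  shows "valid_septoku (s \<circ> rotate_cell)"
proof -
  have rows: "\<forall>R\<in>septoku_rows. rotate_cell ` R \<in> septoku_rows"
    by code_simp
  have circles: "\<forall>C\<in>septoku_circles. rotate_cell ` C \<in> septoku_circles"
    by code_simp
  have cells: "\<forall>c\<in>septoku_cells. rotate_cell c \<in> septoku_cells"
    by code_simp
  have inj: "inj_on rotate_cell septoku_cells"
    by code_simp
  have sub: "\<forall>R\<in>septoku_rows \<union> septoku_circles. R \<subseteq> septoku_cells"
    by code_simp
  show ?thesis
    unfolding valid_septoku_def
  proof (intro conjI ballI)
    show "s \<circ> rotate_cell \<in> septoku_cells \<rightarrow> {1..7}"
      using assms cells by (auto simp: valid_septoku_def Pi_iff)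
  next
    fix R assume "R \<in> septoku_rows"
    then show "inj_on (s \<circ> rotate_cell) R"
      using assms rows sub by (meson UnI1 comp_inj_on inj inj_on_subset valid_septoku_def)
  next
    fix C assume "C \<in> septoku_circles"
    then show "inj_on (s \<circ> rotate_cell) C"
      using assms circles sub by (meson UnI2 comp_inj_on inj inj_on_subset valid_septoku_def)
  qed
qed

theorem theorem1:
  fixes s :: "nat \<Rightarrow> nat"
  assumes "valid_septoku s"
  shows "inj_on s {6, 8, 17, 19, 21, 30, 32}"
proof -
  define r where "r k = s \<circ> (rotate_cell ^^ k)" for k
  have "valid_septoku (r k)" for k
  proof (induction k)
    case 0
    then show ?case using assms by (simp add: r_def)
  next
    case (Suc k)
    then show ?case
      using valid_septoku_rotate[of "r k"] by (simp add: r_def o_def funpow_swap1)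
  qed
  then have "r k 6 \<noteq> r k 21" for k
    by (rule valid_septoku_6_neq_21)
  \<comment> \<open>The rotation cycles the outer centers as 6, 8, 21, 32, 30, 17, so the turned
    pairs are exactly those two apart on this ring.\<close>
  from this[of 0] this[of 1] this[of 2] this[of 3] this[of 4] this[of 5]
  have rotated: "s 6 \<noteq> s 21" "s 8 \<noteq> s 32" "s 21 \<noteq> s 30" "s 32 \<noteq> s 17" "s 30 \<noteq> s 6" "s 17 \<noteq> s 8"
    by (simp_all add: r_def rotate_cell_def eval_nat_numeral)
  note neq = valid_septoku_neq[OF assms]
  note defs = septoku_rows_def horizontal_rows_def up_right_rows_def down_right_rows_def
  \<comment> \<open>The three rows of length seven settle opposite outer centers and every pair
    containing 19.\<close>
  have "inj_on s {6, 19, 32}"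
    using neq[of "{1, 6, 12, 19, 26, 32, 37}"] by (auto simp: defs)
  moreover have "inj_on s {8, 19, 30}"
    using neq[of "{4, 8, 13, 19, 25, 30, 34}"] by (auto simp: defs)
  moreover have "inj_on s {17, 19, 21}"
    using neq[of "{16..22}"] by (auto simp: defs)
  \<comment> \<open>There remain the six pairs of neighbours on the ring, each sharing a
    row.\<close>
  moreover have "s 6 \<noteq> s 8"
    by (rule neq[of "{5..9}"]) (simp_all add: defs)
  moreover have "s 8 \<noteq> s 21"
    by (rule neq[of "{3, 8, 14, 21, 28}"]) (simp_all add: defs)
  moreover have "s 21 \<noteq> s 32"
    by (rule neq[of "{15, 21, 27, 32, 36}"]) (simp_all add: defs)
  moreover have "s 32 \<noteq> s 30"
    by (rule neq[of "{29..33}"]) (simp_all add: defs)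
  moreover have "s 30 \<noteq> s 17"
    by (rule neq[of "{10, 17, 24, 30, 35}"]) (simp_all add: defs)
  moreover have "s 17 \<noteq> s 6"
    by (rule neq[of "{2, 6, 11, 17, 23}"]) (simp_all add: defs)
  ultimately show ?thesis
    using rotated by auto
qed

end
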